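(* In the setting of the context, consider the optimal cell average decomposition (OCAD) for the $\mathbb P^k$-based DG scheme, with optimal boundary weight $\overline\omega_\star=\overline\omega_\star(\theta,\mathbb P^k)$, where $$\theta=\frac{a_1/\Delta x-a_2/\Delta y}{a_1/\Delta x+a_2/\Delta y}.$$ If for all $i,j$ the (limited) DG solution polynomial $\tilde p_{ij}$ satisfies $$\tilde u^+_{i-\frac12,q}\in G,\quad \tilde u^-_{i+\frac12,q}\in G,\quad \tilde u^+_{q,j-\frac12}\in G,\quad \tilde u^-_{q,j+\frac12}\in G,\qquad q=1,\dots,Q,$$ and $$\Pi_{ij}:=\frac{\bar u_{ij}^n-\overline\omega_\star\Big[\frac{1+\theta}2\sum_{q=1}^Q\omega_q^{\mathtt G}\big(\tilde u^+_{i-\frac12,q}+\tilde u^-_{i+\frac12,q}\big)+\frac{1-\theta}2\sum_{q=1}^Q\omega_q^{\mathtt G}\big(\tilde u^+_{q,j-\frac12}+\tilde u^-_{q,j+\frac12}\big)\Big]}{1-2\overline\omega_\star}\in G,$$ then the scheme with the bound-preserving limiter (i.e. the scheme of the context, using the limited polynomials) preserves $\bar u_{ij}^{n+1}\in G$ under the CFL condition $$\Delta t\Big(\frac{a_1}{\Delta x}+\frac{a_2}{\Delta y}\Big)\le\overline\omega_\star\,c_0 .$$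
   Context: Setting. $G\subset\mathbb R^m$ is convex; $a_1,a_2,\Delta x,\Delta y,c_0,\Delta t>0$ ($a_1,a_2$ are the maximum characteristic speeds in the $x$- and $y$-directions); $k\in\mathbb N_+$. The plane is partitioned into rectangles $\Omega_{ij}=[x_{i-\frac12},x_{i+\frac12}]\times[y_{j-\frac12},y_{j+\frac12}]$ of size $\Delta x\times\Delta y$. On each $\Omega_{ij}$ there is an $\mathbb R^m$-valued polynomial $\tilde p_{ij}$ (the DG solution at time level $n$ after limiting) with components in $\mathbb P^k$ (real polynomials of total degree at most $k$) and cell average $\bar u_{ij}^n=\frac1{\Delta x\Delta y}\iint_{\Omega_{ij}}\tilde p_{ij}$. $Q$ is such that the $Q$-point Gauss quadrature rule is exact for univariate polynomials of degree $\le k$; $\omega_q^{\mathtt G}$ are its weights (normalized to sum to one), and $x_{i,q}^{\mathtt G}$, $y_{j,q}^{\mathtt G}$ its nodes in $[x_{i-\frac12},x_{i+\frac12}]$, $[y_{j-\frac12},y_{j+\frac12}]$. In row $j$ (resp. column $i$) the interface values are, for all $i$ (resp. $j$), $$\tilde u^+_{i-\frac12,q}=\tilde p_{ij}(x_{i-\frac12},y_{j,q}^{\mathtt G}),\quad \tilde u^-_{i+\frac12,q}=\tilde p_{ij}(x_{i+\frac12},y_{j,q}^{\mathtt G}),\quad \tilde u^+_{q,j-\frac12}=\tilde p_{ij}(x_{i,q}^{\mathtt G},y_{j-\frac12}),\quad \tilde u^-_{q,j+\frac12}=\tilde p_{ij}(x_{i,q}^{\mathtt G},y_{j+\frac12}).$$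 The scheme for cell averages is $$\bar u_{ij}^{n+1}=\bar u_{ij}^n-\tfrac{\Delta t}{\Delta x}\sum_{q}\omega_q^{\mathtt G}\big[\hat f_1(\tilde u^-_{i+\frac12,q},\tilde u^+_{i+\frac12,q})-\hat f_1(\tilde u^-_{i-\frac12,q},\tilde u^+_{i-\frac12,q})\big]-\tfrac{\Delta t}{\Delta y}\sum_{q}\omega_q^{\mathtt G}\big[\hat f_2(\tilde u^-_{q,j+\frac12},\tilde u^+_{q,j+\frac12})-\hat f_2(\tilde u^-_{q,j-\frac12},\tilde u^+_{q,j-\frac12})\big].$$ The numerical fluxes $\hat f_1,\hat f_2$ are bound-preserving: for $r=1,2$, every $\lambda>0$ with $a_r\lambda\le c_0$ and all $u_1,u_2,u_3\in G$, $u_2-\lambda(\hat f_r(u_2,u_3)-\hat f_r(u_1,u_2))\in G$. Optimal weight. With $\Omega=[-1,1]^2$, $\langle p\rangle_\Omega=\frac14\iint_\Omega p$, $\langle p\rangle_\Omega^x=\frac14\int_{-1}^1[p(-1,y)+p(1,y)]dy$, $\langle p\rangle_\Omega^y=\frac14\int_{-1}^1[p(x,-1)+p(x,1)]dx$, $\overline{p(a,b)}=\frac14[p(a,b)+p(-a,b)+p(a,-b)+p(-a,-b)]$, the number $\overline\omega_\star(\theta,\mathbb P^k)$ is the maximum of all $\overline\omega>0$ for which there is an identity $\langle p\rangle_\Omega=\overline\omega[(1+\theta)\langle p\rangle_\Omega^x+(1-\theta)\langle p\rangle_\Omega^y]+\sum_{s=1}^S\omega_s\overline{p(x^{(s)},y^{(s)})}$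 valid for all $p\in\mathbb P^k$ with $S$ finite, all $\omega_s>0$, all $(x^{(s)},y^{(s)})\in[0,1]^2$ (the maximum is attained); an OCAD is an identity attaining it. *)

theory Defs
  imports "HOL-Analysis.Analysis" "HOL-Computational_Algebra.Polynomial"
begin

section \<open>The polynomial space of total degree at most k\<close>

text \<open>
  Bivariate real polynomials are represented by the functions they induce on the plane; over the
  infinite field of reals this loses nothing.
\<close>

definition PPk :: "nat \<Rightarrow> (real \<times> real \<Rightarrow> real) set" where
  "PPk k = {p. \<exists>c :: nat \<Rightarrow> nat \<Rightarrow> real.
     \<forall>x y. p (x, y) = (\<Sum>a\<le>k. \<Sum>b\<le>k - a. c a b * x ^ a * y ^ b)}"


section \<open>Cell average decompositions on the reference square\<close>

definition ref_avg :: "(real \<times> real \<Rightarrow> real) \<Rightarrow> real" where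
  "ref_avg p = 1/4 * integral (cbox (-1, -1) (1, 1)) p"

definition ref_avg_x :: "(real \<times> real \<Rightarrow> real) \<Rightarrow> real" where
  "ref_avg_x p = 1/4 * integral {-1..1} (\<lambda>y. p (-1, y) + p (1, y))"

definition ref_avg_y :: "(real \<times> real \<Rightarrow> real) \<Rightarrow> real" where
  "ref_avg_y p = 1/4 * integral {-1..1} (\<lambda>x. p (x, -1) + p (x, 1))"

definition sym_avg :: "(real \<times> real \<Rightarrow> real) \<Rightarrow> real \<Rightarrow> real \<Rightarrow> real" where
  "sym_avg p a b = 1/4 * (p (a, b) + p (-a, b) + p (a, -b) + p (-a, -b))"

text \<open>
  The number \<open>S\<close> of internal nodes may be zero. This is needed for \<open>k = 1\<close>, where the largest
  boundary weight is \<open>1/2\<close> and the boundary averages alone already give the cell average.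
\<close>

definition is_CAD ::
  "real \<Rightarrow> nat \<Rightarrow> real \<Rightarrow> nat \<Rightarrow> (nat \<Rightarrow> real) \<Rightarrow> (nat \<Rightarrow> real \<times> real) \<Rightarrow> bool" where
  "is_CAD \<theta> k wb S w z \<longleftrightarrow>
     wb > 0 \<and> (\<forall>s\<in>{1..S}. w s > 0 \<and> z s \<in> {0..1} \<times> {0..1}) \<and>
     (\<forall>p\<in>PPk k. ref_avg p = wb * ((1 + \<theta>) * ref_avg_x p + (1 - \<theta>) * ref_avg_y p)
        + (\<Sum>s=1..S. w s * sym_avg p (fst (z s)) (snd (z s))))"

definition is_optimal_boundary_weight :: "real \<Rightarrow> nat \<Rightarrow> real \<Rightarrow> bool" where
  "is_optimal_boundary_weight \<theta> k wb \<longleftrightarrow>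
     (\<exists>S w z. is_CAD \<theta> k wb S w z) \<and>
     (\<forall>wb' S w z. is_CAD \<theta> k wb' S w z \<longrightarrow> wb' \<le> wb)"


section \<open>Gauss quadrature\<close>

text \<open>Rules on \<open>[-1, 1]\<close> with weights normalized to sum to one, hence the factor \<open>1/2\<close>.\<close>

definition quad_exact :: "nat \<Rightarrow> (nat \<Rightarrow> real) \<Rightarrow> (nat \<Rightarrow> real) \<Rightarrow> nat \<Rightarrow> bool" where
  "quad_exact Q w \<xi> d \<longleftrightarrow>
     (\<forall>p :: real poly. degree p \<le> d \<longrightarrow>
        1/2 * integral {-1..1} (poly p) = (\<Sum>q=1..Q. w q * poly p (\<xi> q)))"

text \<open>The \<open>Q\<close>-point Gauss rule is the rule with \<open>Q\<close> distinct nodes exact up to degree \<open>2Q - 1\<close>.\<close>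

definition gauss_rule :: "nat \<Rightarrow> (nat \<Rightarrow> real) \<Rightarrow> (nat \<Rightarrow> real) \<Rightarrow> bool" where
  "gauss_rule Q w \<xi> \<longleftrightarrow>
     1 \<le> Q \<and> inj_on \<xi> {1..Q} \<and> \<xi> ` {1..Q} \<subseteq> {-1..1} \<and> quad_exact Q w \<xi> (2 * Q - 1)"

definition gauss_node :: "real \<Rightarrow> real \<Rightarrow> real \<Rightarrow> real" where
  "gauss_node l r \<xi> = (l + r) / 2 + (r - l) / 2 * \<xi>"


section \<open>The scheme\<close>

text \<open>
  Half-integer indices are encoded by integers: \<open>xh i\<close> stands for the grid line with index
  \<open>i - 1/2\<close>, so the cell with index \<open>(i, j)\<close> is \<open>[xh i, xh (i + 1)] \<times> [yh j, yh (j + 1)]\<close>. Values at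
  cell interfaces are indexed in the same way.
\<close>

definition uniform_grid :: "real \<Rightarrow> (int \<Rightarrow> real) \<Rightarrow> bool" where
  "uniform_grid h xh \<longleftrightarrow> (\<forall>i. xh (i + 1) = xh i + h)"

definition bound_preserving_flux ::
  "('v :: real_vector) set \<Rightarrow> real \<Rightarrow> real \<Rightarrow> ('v \<Rightarrow> 'v \<Rightarrow> 'v) \<Rightarrow> bool" where
  "bound_preserving_flux G a c0 f \<longleftrightarrow>
     (\<forall>l>0. a * l \<le> c0 \<longrightarrow>
        (\<forall>u1\<in>G. \<forall>u2\<in>G. \<forall>u3\<in>G. u2 - l *\<^sub>R (f u2 u3 - f u1 u2) \<in> G))"

end

theory Submission
  imports Defs
begin

text \<open>
  The optimal weight is at most \<open>1/2\<close>, as the test polynomial \<open>1\<close> shows. Subtracting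
  and adding the flux between the two interface values inside a cell writes the new average as
  \<open>(1 - 2 \<omega>) \<Pi>\<close> plus \<open>2 \<omega>\<close> times a convex combination of one-dimensional three-point updates,
  which lie in \<open>G\<close> under the CFL condition. When the optimal weight equals \<open>1/2\<close>, where \<open>\<Pi>\<close> is
  undefined, there are no internal nodes, and the test polynomial \<open>x\<^sup>2\<close> forces \<open>k \<le> 1\<close>; the first
  summand then vanishes because the boundary averages of an affine function give its cell average.
\<close>

section \<open>Gauss rules\<close>

text \<open>Exactness is tested on the square of \<open>L\<close>, which vanishes at every node
  except the one of index \<open>q\<close>. Its degree is at most \<open>2 * Q - 2\<close>, so the
  weight times a positive number equals half the integral of a nonnegative function.\<close>

lemma gauss_rule_weight_nonneg:
  assumes "gauss_rule Q w \<xi>" "q \<in> {1..Q}"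
  shows "w q \<ge> 0"
proof -
  define L where "L = (\<Prod>r\<in>{1..Q}-{q}. [:-\<xi> r, 1:])"
  have inj: "inj_on \<xi> {1..Q}" and exact: "quad_exact Q w \<xi> (2 * Q - 1)"
    using assms(1) by (auto simp: gauss_rule_def)
  have "degree L = Q - 1"
    using assms(2) by (simp add: L_def degree_prod_eq_sum_degree)
  then have deg: "degree (L ^ 2) \<le> 2 * Q - 1"
    using degree_power_le[of L 2] by linarith
  have at_other: "poly L (\<xi> r) = 0" if "r \<in> {1..Q}" "r \<noteq> q" for r
    using that by (auto simp: L_def poly_prod)
  have at_q: "poly L (\<xi> q) \<noteq> 0"
    using assms(2) by (auto simp: L_def poly_prod dest: inj_onD[OF inj])
  have "(\<Sum>r=1..Q. w r * poly (L ^ 2) (\<xi> r))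
      = (\<Sum>r=1..Q. if r = q then w q * (poly L (\<xi> q))\<^sup>2 else 0)"
    by (intro sum.cong) (auto simp: at_other)
  also have "\<dots> = w q * (poly L (\<xi> q))\<^sup>2"
    using assms(2) by simp
  finally have "w q * (poly L (\<xi> q))\<^sup>2 = 1/2 * integral {-1..1} (poly (L ^ 2))"
    using exact[unfolded quad_exact_def, rule_format, OF deg] by (metis (no_types))
  also have "\<dots> \<ge> 0"
  proof -
    have "poly (L ^ 2) integrable_on {-1..1}"
      by (intro integrable_continuous_interval continuous_intros)
    then have "integral {-1..1} (poly (L ^ 2)) \<ge> 0"
      by (rule Henstock_Kurzweil_Integration.integral_nonneg) simp
    then show ?thesis
      by simp
  qed
  finally show ?thesis
    using at_q by (simp add: zero_le_mult_iff)
qed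

lemma integral_affine:
  fixes A B :: "'a::euclidean_space"
  assumes "l \<le> r"
  shows "integral {l..r} (\<lambda>t. A + t *\<^sub>R B) = (r - l) *\<^sub>R (A + ((l + r) / 2) *\<^sub>R B)"
proof -
  have "((\<lambda>t. A + t *\<^sub>R B) has_integral ((r - l) *\<^sub>R A + ((r\<^sup>2 - l\<^sup>2) / 2) *\<^sub>R B)) {l..r}"
    using has_integral_add[OF has_integral_const_real
        has_integral_scaleR_left[OF ident_has_integral[OF assms]], of A B] assms
    by simp
  moreover have "(r\<^sup>2 - l\<^sup>2) / 2 = (r - l) * ((l + r) / 2)"
    by (simp add: power2_eq_square algebra_simps)
  ultimately show ?thesis
    by (simp add: integral_unique scaleR_add_right)
qed

text \<open>As \<open>Q\<close> is at least 1, exactness reaches degree 1, so the constant and the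
  identity may serve as test polynomials.\<close>

lemma gauss_rule_moments:
  assumes "gauss_rule Q w \<xi>"
  shows "(\<Sum>q=1..Q. w q) = 1" "(\<Sum>q=1..Q. w q * \<xi> q) = 0"
proof -
  have exact: "quad_exact Q w \<xi> (2 * Q - 1)" and Q: "Q \<ge> 1"
    using assms by (auto simp: gauss_rule_def)
  have "1/2 * integral {-1..1} (poly [:1:]) = (\<Sum>q=1..Q. w q * poly [:1:] (\<xi> q))"
    using exact[unfolded quad_exact_def, rule_format, of "[:1:]"] by simp
  moreover have "poly [:1:] = (\<lambda>_. 1 :: real)"
    by (simp add: fun_eq_iff)
  ultimately show "(\<Sum>q=1..Q. w q) = 1"
    by simp
  have "1/2 * integral {-1..1} (poly [:0, 1:]) = (\<Sum>q=1..Q. w q * poly [:0, 1:] (\<xi> q))"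
    using exact[unfolded quad_exact_def, rule_format, of "[:0, 1:]"] Q by simp
  moreover have "poly [:0, 1:] = (\<lambda>t. 0 + t *\<^sub>R (1::real))"
    by (simp add: fun_eq_iff)
  then have "integral {-1..1} (poly [:0, 1:]) = (0::real)"
    by (simp only: integral_affine) simp
  ultimately show "(\<Sum>q=1..Q. w q * \<xi> q) = 0"
    by simp
qed

text \<open>The vanishing first moment removes the offsets of the nodes from the midpoint and leaves
  the midpoint value. This evaluates the averages over the sides of a cell when the solution is
  affine.\<close>

lemma gauss_rule_affine:
  fixes A B :: "'a::real_vector"
  assumes "gauss_rule Q w \<xi>"
  shows "(\<Sum>q=1..Q. w q *\<^sub>R (A + gauss_node l r (\<xi> q) *\<^sub>R B)) = A + ((l + r) / 2) *\<^sub>R B"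
proof -
  have "(\<Sum>q=1..Q. w q *\<^sub>R (A + gauss_node l r (\<xi> q) *\<^sub>R B))
      = (\<Sum>q=1..Q. w q *\<^sub>R (A + ((l + r) / 2) *\<^sub>R B) + (w q * \<xi> q) *\<^sub>R (((r - l) / 2) *\<^sub>R B))"
    by (simp add: gauss_node_def scaleR_add_left scaleR_add_right mult.commute mult.left_commute add.assoc)
  also have "\<dots> = (\<Sum>q=1..Q. w q) *\<^sub>R (A + ((l + r) / 2) *\<^sub>R B)
      + (\<Sum>q=1..Q. w q * \<xi> q) *\<^sub>R (((r - l) / 2) *\<^sub>R B)"
    by (simp only: sum.distrib scaleR_sum_left)
  finally show ?thesis
    by (simp only: gauss_rule_moments[OF assms]) simp
qed

section \<open>Boundary weights of decompositions\<close>

text \<open>Supplies the test polynomials for decompositions: exponent 0 for the sum of the weights,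
  exponent 2 for the boundary weight \<open>1/2\<close>.\<close>

lemma fst_power_in_PPk:
  assumes "n \<le> k"
  shows "(\<lambda>z. fst z ^ n) \<in> PPk k"
proof -
  define c :: "nat \<Rightarrow> nat \<Rightarrow> real" where "c = (\<lambda>a b. if a = n then if b = 0 then 1 else 0 else 0)"
  have "(\<Sum>a\<le>k. \<Sum>b\<le>k - a. c a b * x ^ a * y ^ b) = x ^ n" for x y
  proof -
    have "(\<Sum>b\<le>k - a. c a b * x ^ a * y ^ b) = (if a = n then x ^ n else 0)" for a
      by (simp add: c_def if_distrib[where f="\<lambda>c. c * _"] cong: if_cong)
    then show ?thesis
      using assms by simp
  qed
  then show ?thesis
    by (auto simp: PPk_def intro!: exI[of _ c])
qed

lemma PPk_le_1_affine:
  assumes "g \<in> PPk k" "k \<le> 1"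
  obtains A B C where "\<And>x y. g (x, y) = A + x * B + y * C"
proof -
  obtain c where c: "\<And>x y. g (x, y) = (\<Sum>a\<le>k. \<Sum>b\<le>k - a. c a b * x ^ a * y ^ b)"
    using assms(1) by (auto simp: PPk_def)
  consider "k = 0" | "k = 1"
    using assms(2) by linarith
  then show thesis
  proof cases
    case 1
    then show thesis
      using c by (intro that[of "c 0 0" 0 0]) auto
  next
    case 2
    then show thesis
      using c by (intro that[of "c 0 0" "c 1 0" "c 0 1"]) auto
  qed
qed

text \<open>All averages of the constant 1 equal 1, and \<open>\<theta>\<close> cancels in the
  boundary term.\<close>

lemma is_CAD_weights:
  assumes "is_CAD \<theta> k wb S w z"
  shows "2 * wb + (\<Sum>s=1..S. w s) = 1"
proof -
  have "ref_avg (\<lambda>_. 1) = wb * ((1 + \<theta>) * ref_avg_x (\<lambda>_. 1) + (1 - \<theta>) * ref_avg_y (\<lambda>_. 1))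
        + (\<Sum>s=1..S. w s * sym_avg (\<lambda>_. 1) (fst (z s)) (snd (z s)))"
    using assms fst_power_in_PPk[of 0 k] unfolding is_CAD_def by auto
  moreover have "ref_avg (\<lambda>_. 1) = 1"
    by (simp add: ref_avg_def content_Pair)
  ultimately show ?thesis
    by (simp add: ref_avg_x_def ref_avg_y_def sym_avg_def algebra_simps)
qed

lemma is_CAD_weight_le_half:
  assumes "is_CAD \<theta> k wb S w z"
  shows "wb \<le> 1/2"
proof -
  have "(\<Sum>s=1..S. w s) \<ge> 0"
    using assms by (intro sum_nonneg) (auto simp: is_CAD_def intro: less_imp_le)
  then show ?thesis
    using is_CAD_weights[OF assms] by linarith
qed

text \<open>Boundary weight \<open>1/2\<close> leaves no mass for internal nodes. If the square of
  the first coordinate were admissible, the identity would read 1/3 = (2 + \<theta>)/3, forcing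
  \<theta> = -1.\<close>

lemma is_CAD_weight_half_degree:
  assumes "is_CAD \<theta> k (1/2) S w z" "\<theta> > -1"
  shows "k \<le> 1"
proof (rule ccontr)
  assume "\<not> k \<le> 1"
  define g :: "real \<times> real \<Rightarrow> real" where "g = (\<lambda>z. (fst z)\<^sup>2)"
  have "g \<in> PPk k"
    using fst_power_in_PPk[of 2 k] \<open>\<not> k \<le> 1\<close> by (simp add: g_def)
  have "(\<Sum>s=1..S. w s) = 0"
    using is_CAD_weights[OF assms(1)] by simp
  then have "\<forall>s\<in>{1..S}. w s = 0"
    using assms(1) by (subst (asm) sum_nonneg_eq_0_iff) (auto simp: is_CAD_def intro: less_imp_le)
  with \<open>g \<in> PPk k\<close> assms(1) have
    eq: "ref_avg g = 1/2 * ((1 + \<theta>) * ref_avg_x g + (1 - \<theta>) * ref_avg_y g)"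
    unfolding is_CAD_def by fastforce
  have "((\<lambda>x::real. x\<^sup>2) has_integral (1 ^ 3 / 3 - (-1) ^ 3 / 3)) {-1..1}"
    by (intro fundamental_theorem_of_calculus)
       (auto intro!: derivative_eq_intros simp flip: has_real_derivative_iff_has_vector_derivative)
  then have sq: "integral {-1..1} (\<lambda>x::real. x\<^sup>2) = 2/3"
    by (simp add: integral_unique)
  have "integral (cbox (-1, -1) (1, 1)) g
      = integral (cbox (-1) 1) (\<lambda>x. integral (cbox (-1) 1) (\<lambda>y. g (x, y)))"
    by (intro integral_prod_continuous) (auto simp: g_def intro!: continuous_intros)
  also have "\<dots> = 4/3"
    by (simp add: g_def sq)
  finally have "ref_avg g = 1/3"
    by (simp add: ref_avg_def)
  moreover have "ref_avg_x g = 1" "ref_avg_y g = 1/3"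
    by (simp_all add: ref_avg_x_def ref_avg_y_def g_def sq)
  ultimately show False
    using eq assms(2) by (simp add: field_simps)
qed

lemma cell_average_affine:
  fixes A B C :: "'a::euclidean_space"
  assumes "xl \<le> xr" "yl \<le> yr" and f: "\<And>x y. f (x, y) = A + x *\<^sub>R B + y *\<^sub>R C"
  shows "integral (cbox (xl, yl) (xr, yr)) f
    = ((xr - xl) * (yr - yl)) *\<^sub>R (A + ((xl + xr) / 2) *\<^sub>R B + ((yl + yr) / 2) *\<^sub>R C)"
proof -
  have f': "f = (\<lambda>z. A + fst z *\<^sub>R B + snd z *\<^sub>R C)"
    using f by (auto simp: fun_eq_iff)
  have "integral (cbox (xl, yl) (xr, yr)) f
      = integral (cbox xl xr) (\<lambda>x. integral (cbox yl yr) (\<lambda>y. f (x, y)))"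
    by (intro integral_prod_continuous) (auto simp: f' intro!: continuous_intros)
  also have "\<dots> = integral {xl..xr}
      (\<lambda>x. (yr - yl) *\<^sub>R (A + ((yl + yr) / 2) *\<^sub>R C) + x *\<^sub>R ((yr - yl) *\<^sub>R B))"
  proof -
    have "integral (cbox yl yr) (\<lambda>y. f (x, y))
        = (yr - yl) *\<^sub>R (A + ((yl + yr) / 2) *\<^sub>R C) + x *\<^sub>R ((yr - yl) *\<^sub>R B)" for x
      using integral_affine[OF assms(2), of "A + x *\<^sub>R B" C] by (simp add: f algebra_simps)
    then show ?thesis
      by simp
  qed
  also have "\<dots> = (xr - xl) *\<^sub>R ((yr - yl) *\<^sub>R (A + ((yl + yr) / 2) *\<^sub>R C)
      + ((xl + xr) / 2) *\<^sub>R ((yr - yl) *\<^sub>R B))"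
    using integral_affine[OF assms(1)] .
  also have "\<dots> = ((xr - xl) * (yr - yl)) *\<^sub>R
      (A + ((xl + xr) / 2) *\<^sub>R B + ((yl + yr) / 2) *\<^sub>R C)"
    by (simp add: scaleR_add_right ac_simps)
  finally show ?thesis .
qed

section \<open>The update of cell averages\<close>

text \<open>Here \<open>v\<close>, \<open>u\<close> are the left and \<open>u'\<close>, \<open>v'\<close> the right interface values in one direction,
  and \<open>\<kappa>\<close> is the share of the boundary weight that this direction receives.\<close>

lemma directional_update:
  fixes w :: "nat \<Rightarrow> real" and u u' v v' :: "nat \<Rightarrow> 'a::real_vector"
  assumes "convex G" and flux: "bound_preserving_flux G a c0 f"
    and w: "\<forall>q\<in>{1..Q}. w q \<ge> 0" "(\<Sum>q=1..Q. w q) = 1"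
    and in_G: "\<forall>q\<in>{1..Q}. v q \<in> G \<and> u q \<in> G \<and> u' q \<in> G \<and> v' q \<in> G"
    and "\<kappa> > 0" "h > 0" "a * h \<le> \<kappa> * c0"
  obtains m where "m \<in> G"
    "\<kappa> *\<^sub>R (\<Sum>q=1..Q. w q *\<^sub>R (u q + u' q))
      - h *\<^sub>R (\<Sum>q=1..Q. w q *\<^sub>R (f (u' q) (v' q) - f (v q) (u q)))
      = (2 * \<kappa>) *\<^sub>R m"
proof -
  \<comment> \<open>The time step as seen by this direction: dividing by its share of the boundary
    weight turns \<open>a * h \<le> \<kappa> * c0\<close> into the condition under which the flux is
    bound-preserving.\<close>
  define l where "l = h / \<kappa>"
  have l: "l > 0" "a * l \<le> c0" "\<kappa> * l = h"
    using assms by (simp_all add: l_def field_simps)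
  \<comment> \<open>Three-point updates centred at the two interface values of the cell. The
    artificial flux \<open>f (u q) (u' q)\<close> enters them with opposite signs and cancels in
    their sum.\<close>
  define L where "L q = u q - l *\<^sub>R (f (u q) (u' q) - f (v q) (u q))" for q
  define R where "R q = u' q - l *\<^sub>R (f (u' q) (v' q) - f (u q) (u' q))" for q
  have "(1/2) *\<^sub>R L q + (1/2) *\<^sub>R R q \<in> G" if "q \<in> {1..Q}" for q
  proof (intro convexD[OF \<open>convex G\<close>])
    show "L q \<in> G" "R q \<in> G"
      using flux l in_G that unfolding bound_preserving_flux_def L_def R_def by blast+
  qed auto
  then have "(\<Sum>q=1..Q. w q *\<^sub>R ((1/2) *\<^sub>R L q + (1/2) *\<^sub>R R q)) \<in> G"
    using w by (intro convex_sum \<open>convex G\<close>) auto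
  moreover have "\<kappa> *\<^sub>R (\<Sum>q=1..Q. w q *\<^sub>R (u q + u' q))
      - h *\<^sub>R (\<Sum>q=1..Q. w q *\<^sub>R (f (u' q) (v' q) - f (v q) (u q)))
      = (2 * \<kappa>) *\<^sub>R (\<Sum>q=1..Q. w q *\<^sub>R ((1/2) *\<^sub>R L q + (1/2) *\<^sub>R R q))"
    unfolding scaleR_sum_right sum_subtractf[symmetric] L_def R_def l(3)[symmetric]
    by (intro sum.cong refl) (simp add: algebra_simps)
  ultimately show thesis
    by (rule that)
qed

theorem theorem7p5:
  fixes G :: "(real ^ 'm) set"
    and a1 a2 dx dy c0 dt wb \<theta> :: real
    and k Q :: nat
    and xh yh :: "int \<Rightarrow> real"
    and p :: "int \<Rightarrow> int \<Rightarrow> real \<times> real \<Rightarrow> real ^ 'm"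
    and wG \<xi> :: "nat \<Rightarrow> real"
    and f1 f2 :: "real ^ 'm \<Rightarrow> real ^ 'm \<Rightarrow> real ^ 'm"
    and ubar unext :: "int \<Rightarrow> int \<Rightarrow> real ^ 'm"
    and um1 up1 um2 up2 :: "int \<Rightarrow> int \<Rightarrow> nat \<Rightarrow> real ^ 'm"
  assumes "convex G"
    and "a1 > 0" "a2 > 0" "dx > 0" "dy > 0" "c0 > 0" "dt > 0" "k \<ge> 1"
    and "uniform_grid dx xh" "uniform_grid dy yh"
    and poly: "\<And>i j l. (\<lambda>z. p i j z $ l) \<in> PPk k"
    and gauss: "gauss_rule Q wG \<xi>" "quad_exact Q wG \<xi> k"
    and flux: "bound_preserving_flux G a1 c0 f1" "bound_preserving_flux G a2 c0 f2"
    and theta: "\<theta> = (a1 / dx - a2 / dy) / (a1 / dx + a2 / dy)"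
    and weight: "is_optimal_boundary_weight \<theta> k wb"
    and ubar: "\<And>i j. ubar i j =
          (1 / (dx * dy)) *\<^sub>R integral (cbox (xh i, yh j) (xh (i + 1), yh (j + 1))) (p i j)"
    and up1: "\<And>i j q. up1 i j q = p i j (xh i, gauss_node (yh j) (yh (j + 1)) (\<xi> q))"
    and um1: "\<And>i j q. um1 (i + 1) j q = p i j (xh (i + 1), gauss_node (yh j) (yh (j + 1)) (\<xi> q))"
    and up2: "\<And>i j q. up2 i j q = p i j (gauss_node (xh i) (xh (i + 1)) (\<xi> q), yh j)"
    and um2: "\<And>i j q. um2 i (j + 1) q = p i j (gauss_node (xh i) (xh (i + 1)) (\<xi> q), yh (j + 1))"
    and scheme: "\<And>i j. unext i j = ubar i j
          - (dt / dx) *\<^sub>R (\<Sum>q=1..Q. wG q *\<^sub>R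
              (f1 (um1 (i + 1) j q) (up1 (i + 1) j q) - f1 (um1 i j q) (up1 i j q)))
          - (dt / dy) *\<^sub>R (\<Sum>q=1..Q. wG q *\<^sub>R
              (f2 (um2 i (j + 1) q) (up2 i (j + 1) q) - f2 (um2 i j q) (up2 i j q)))"
    and interface: "\<And>i j q. q \<in> {1..Q} \<Longrightarrow>
          up1 i j q \<in> G \<and> um1 (i + 1) j q \<in> G \<and> up2 i j q \<in> G \<and> um2 i (j + 1) q \<in> G"
    and Pi: "\<And>i j. 1 - 2 * wb \<noteq> 0 \<Longrightarrow>
          (ubar i j - wb *\<^sub>R
              (((1 + \<theta>) / 2) *\<^sub>R (\<Sum>q=1..Q. wG q *\<^sub>R (up1 i j q + um1 (i + 1) j q))
             + ((1 - \<theta>) / 2) *\<^sub>R (\<Sum>q=1..Q. wG q *\<^sub>R (up2 i j q + um2 i (j + 1) q))))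
          /\<^sub>R (1 - 2 * wb) \<in> G"
    and CFL: "dt * (a1 / dx + a2 / dy) \<le> wb * c0"
  shows "\<forall>i j. unext i j \<in> G"
proof (intro allI)
  fix i j
  define s where "s = a1 / dx + a2 / dy"
  define \<kappa>1 where "\<kappa>1 = wb * ((1 + \<theta>) / 2)"
  define \<kappa>2 where "\<kappa>2 = wb * ((1 - \<theta>) / 2)"
  define E1 where "E1 = (\<Sum>q=1..Q. wG q *\<^sub>R (up1 i j q + um1 (i + 1) j q))"
  define E2 where "E2 = (\<Sum>q=1..Q. wG q *\<^sub>R (up2 i j q + um2 i (j + 1) q))"
  define H where "H = ubar i j - (\<kappa>1 *\<^sub>R E1 + \<kappa>2 *\<^sub>R E2)"
  obtain S w z where CAD: "is_CAD \<theta> k wb S w z"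
    using weight by (auto simp: is_optimal_boundary_weight_def)
  have wb: "wb > 0" "wb \<le> 1/2"
    using CAD is_CAD_weight_le_half[OF CAD] by (auto simp: is_CAD_def)
  have s: "s > 0"
    using \<open>a1 > 0\<close> \<open>a2 > 0\<close> \<open>dx > 0\<close> \<open>dy > 0\<close> by (simp add: s_def add_pos_pos)
  \<comment> \<open>This choice of \<theta> splits the boundary weight in proportion to
    \<open>a1 / dx\<close> and \<open>a2 / dy\<close>, so that the single CFL condition yields
    exactly the condition required in each direction.\<close>
  have "\<theta> + 1 = 2 * (a1 / dx) / s" "1 - \<theta> = 2 * (a2 / dy) / s"
    using s unfolding theta s_def[symmetric]
    by (simp_all add: field_simps) (simp_all add: s_def field_simps)
  then have \<kappa>_eq: "\<kappa>1 = wb * (a1 / dx) / s" "\<kappa>2 = wb * (a2 / dy) / s"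
    by (simp_all add: \<kappa>1_def \<kappa>2_def add.commute)
  have \<kappa>: "\<kappa>1 > 0" "\<kappa>2 > 0" "\<kappa>1 + \<kappa>2 = wb"
    using wb s \<open>a1 > 0\<close> \<open>a2 > 0\<close> \<open>dx > 0\<close> \<open>dy > 0\<close>
    by (simp add: \<kappa>_eq, simp add: \<kappa>_eq, simp add: \<kappa>1_def \<kappa>2_def field_simps)
  have "\<theta> > -1"
    using \<kappa>(1) wb(1) by (simp add: \<kappa>1_def zero_less_mult_iff)
  have dt_s: "dt \<le> wb * c0 / s"
    using CFL s by (simp add: s_def[symmetric] pos_le_divide_eq)
  have cfl1: "a1 * (dt / dx) \<le> \<kappa>1 * c0"
    using mult_left_mono[OF dt_s, of "a1 / dx"] \<open>a1 > 0\<close> \<open>dx > 0\<close>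
    by (simp add: \<kappa>_eq mult.commute mult.left_commute)
  have cfl2: "a2 * (dt / dy) \<le> \<kappa>2 * c0"
    using mult_left_mono[OF dt_s, of "a2 / dy"] \<open>a2 > 0\<close> \<open>dy > 0\<close>
    by (simp add: \<kappa>_eq mult.commute mult.left_commute)
  have dt_pos: "dt / dx > 0" "dt / dy > 0"
    using \<open>dt > 0\<close> \<open>dx > 0\<close> \<open>dy > 0\<close> by simp_all
  have w: "\<forall>q\<in>{1..Q}. wG q \<ge> 0" "(\<Sum>q=1..Q. wG q) = 1"
    using gauss_rule_weight_nonneg[OF gauss(1)] gauss_rule_moments(1)[OF gauss(1)] by blast+
  \<comment> \<open>The outer values belong to the neighbouring cells, hence the shifted
    indices.\<close>
  have in_G:
    "\<forall>q\<in>{1..Q}. um1 i j q \<in> G \<and> up1 i j q \<in> G \<and> um1 (i + 1) j q \<in> G \<and> up1 (i + 1) j q \<in> G"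
    "\<forall>q\<in>{1..Q}. um2 i j q \<in> G \<and> up2 i j q \<in> G \<and> um2 i (j + 1) q \<in> G \<and> up2 i (j + 1) q \<in> G"
    using interface[of _ i j] interface[of _ "i - 1" j] interface[of _ "i + 1" j]
      interface[of _ i "j - 1"] interface[of _ i "j + 1"] by simp_all
  obtain m1 where m1: "m1 \<in> G" "\<kappa>1 *\<^sub>R E1 - (dt / dx) *\<^sub>R (\<Sum>q=1..Q. wG q *\<^sub>R
      (f1 (um1 (i + 1) j q) (up1 (i + 1) j q) - f1 (um1 i j q) (up1 i j q))) = (2 * \<kappa>1) *\<^sub>R m1"
    using directional_update[OF \<open>convex G\<close> flux(1) w in_G(1) \<kappa>(1) dt_pos(1) cfl1]
    unfolding E1_def by blast
  obtain m2 where m2: "m2 \<in> G" "\<kappa>2 *\<^sub>R E2 - (dt / dy) *\<^sub>R (\<Sum>q=1..Q. wG q *\<^sub>R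
      (f2 (um2 i (j + 1) q) (up2 i (j + 1) q) - f2 (um2 i j q) (up2 i j q))) = (2 * \<kappa>2) *\<^sub>R m2"
    using directional_update[OF \<open>convex G\<close> flux(2) w in_G(2) \<kappa>(2) dt_pos(2) cfl2]
    unfolding E2_def by blast
  \<comment> \<open>The coefficients are positive and sum to 1 because
    \<open>\<kappa>1 + \<kappa>2 = wb\<close>.\<close>
  define m where "m = (\<kappa>1 / wb) *\<^sub>R m1 + (\<kappa>2 / wb) *\<^sub>R m2"
  have "m \<in> G"
    unfolding m_def using \<kappa> wb m1(1) m2(1)
    by (intro convexD[OF \<open>convex G\<close>]) (auto simp flip: add_divide_distrib)
  have "unext i j = H + ((2 * \<kappa>1) *\<^sub>R m1 + (2 * \<kappa>2) *\<^sub>R m2)"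
    unfolding scheme H_def m1(2)[symmetric] m2(2)[symmetric] by simp
  then have unext: "unext i j = H + (2 * wb) *\<^sub>R m"
    using wb by (simp add: m_def scaleR_add_right)
  show "unext i j \<in> G"
  proof (cases "wb = 1/2")
    case True
    \<comment> \<open>The hypothesis on the quotient gives nothing here, so \<open>H = 0\<close> has
      to come from the solution being affine on the cell.\<close>
    then have "k \<le> 1"
      using is_CAD_weight_half_degree CAD \<open>\<theta> > -1\<close> by blast
    have "\<forall>l. \<exists>A B C. \<forall>x y. p i j (x, y) $ l = A + x * B + y * C"
      using PPk_le_1_affine[OF poly \<open>k \<le> 1\<close>] by metis
    then obtain A B C where "\<And>l x y. p i j (x, y) $ l = A l + x * B l + y * C l"
      by metis
    then have p: "p i j (x, y) = (\<chi> l. A l) + x *\<^sub>R (\<chi> l. B l) + y *\<^sub>R (\<chi> l. C l)" for x y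
      by (simp add: vec_eq_iff)
    define c where "c = (\<chi> l. A l) + ((xh i + xh (i + 1)) / 2) *\<^sub>R (\<chi> l. B l)
      + ((yh j + yh (j + 1)) / 2) *\<^sub>R (\<chi> l. C l)"
    have grid: "xh (i + 1) = xh i + dx" "yh (j + 1) = yh j + dy"
      using \<open>uniform_grid dx xh\<close> \<open>uniform_grid dy yh\<close> by (simp_all add: uniform_grid_def)
    have "ubar i j = c"
      using \<open>dx > 0\<close> \<open>dy > 0\<close>
      by (simp add: ubar cell_average_affine[OF _ _ p] grid c_def)
    \<comment> \<open>On horizontal sides \<open>x\<close> is the quadrature variable; it is moved
      last to match \<open>gauss_rule_affine\<close>.\<close>
    have swap: "p i j (x, y) = ((\<chi> l. A l) + y *\<^sub>R (\<chi> l. C l)) + x *\<^sub>R (\<chi> l. B l)" for x y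
      by (simp add: p)
    \<comment> \<open>The quadrature yields the midpoint values of two opposite sides, which add up
      to twice the value \<open>c\<close> at the cell centre. The instantiated rule splits only the
      sum over the two sides.\<close>
    have "E1 = 2 *\<^sub>R c"
      unfolding E1_def up1 um1 p scaleR_add_right[of "wG _" "_ + _ *\<^sub>R (\<chi> l. C l)"]
        sum.distrib gauss_rule_affine[OF gauss(1)]
      by (simp add: c_def vec_eq_iff field_simps)
    moreover have "E2 = 2 *\<^sub>R c"
      unfolding E2_def up2 um2 swap scaleR_add_right[of "wG _" "_ + _ *\<^sub>R (\<chi> l. B l)"]
        sum.distrib gauss_rule_affine[OF gauss(1)]
      by (simp add: c_def vec_eq_iff field_simps)
    ultimately have "\<kappa>1 *\<^sub>R E1 + \<kappa>2 *\<^sub>R E2 = (2 * (\<kappa>1 + \<kappa>2)) *\<^sub>R c"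
      by (simp add: algebra_simps)
    then have "H = 0"
      using \<open>ubar i j = c\<close> by (simp add: H_def \<kappa>(3) True)
    then show ?thesis
      using unext \<open>m \<in> G\<close> True by simp
  next
    case False
    \<comment> \<open>\<open>H\<close> is the numerator of the assumed quotient, so the update is a
      convex combination of that quotient and \<open>m\<close>.\<close>
    then have "H /\<^sub>R (1 - 2 * wb) \<in> G"
      using Pi[of i j] by (simp add: H_def \<kappa>1_def \<kappa>2_def E1_def E2_def scaleR_add_right)
    then have "(1 - 2 * wb) *\<^sub>R (H /\<^sub>R (1 - 2 * wb)) + (2 * wb) *\<^sub>R m \<in> G"
      using wb \<open>m \<in> G\<close> by (intro convexD[OF \<open>convex G\<close>]) auto
    then show ?thesis
      using False by (simp add: unext)
  qed
qed

end
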